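(* Consider the following synchronous message-passing model for computing connected components of an undirected graph $G$ with vertex set $[n]=\{1,\dots,n\}$. Every vertex and every edge is a processor with local memory. Computation proceeds in synchronous steps; in a step, each vertex and each edge may update its local memory based on the messages sent to it in the previous step, and then send a message to each vertex and edge it knows about. Initially a vertex knows only about itself and an edge knows only about its two ends; a vertex or edge comes to know about another vertex or edge once it has received a message containing it. An algorithm in this model computes connected components if at its end every vertex $v$ holds a label which is a vertex of the component of $v$, such that two vertices have the same label if and only if they lie in the same connected component. Then any such algorithm takes $\Omega(\lg d)$ steps on a graph $G$, where $d$ is the maximum of the diameters of the connected components of $G$.
   Context: $\lg$ denotes the base-two logarithm. The diameter of a connected component is the maximum over pairs of its vertices of their graph distance. *)

theory Defs
  imports Complex_Main "HOL-Library.Multiset"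
begin

definition simple_graph :: "nat \<Rightarrow> nat set set \<Rightarrow> bool" where
  "simple_graph n E \<longleftrightarrow> (\<forall>e\<in>E. e \<subseteq> {1..n} \<and> card e = 2)"

definition adj :: "nat set set \<Rightarrow> nat rel" where
  "adj E = {(u, v). {u, v} \<in> E}"

definition components :: "nat \<Rightarrow> nat set set \<Rightarrow> nat set set" where
  "components n E = {1..n} // (adj E)\<^sup>*"

definition component_of :: "nat set set \<Rightarrow> nat \<Rightarrow> nat set" where
  "component_of E v = (adj E)\<^sup>* `` {v}"

text \<open>Only used for \<open>u\<close> and \<open>v\<close> in the same component, where a walk exists.\<close>

definition graph_dist :: "nat set set \<Rightarrow> nat \<Rightarrow> nat \<Rightarrow> nat" where
  "graph_dist E u v = (LEAST k. (u, v) \<in> adj E ^^ k)"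

definition diameter :: "nat set set \<Rightarrow> nat set \<Rightarrow> nat" where
  "diameter E C = Max {graph_dist E u v |u v. u \<in> C \<and> v \<in> C}"

definition max_diameter :: "nat \<Rightarrow> nat set set \<Rightarrow> nat" where
  "max_diameter n E = Max (diameter E ` components n E)"

datatype node = Vert nat | Edge "nat set"

definition nodes :: "nat \<Rightarrow> nat set set \<Rightarrow> node set" where
  "nodes n E = Vert ` {1..n} \<union> Edge ` E"

text \<open>
  Memories (\<open>'s\<close>) and messages (\<open>'m\<close>) are arbitrary data; \<open>held\<close> and \<open>contents\<close> give the vertices
  and edges occurring in them. A processor's initial memory depends only on its own identity
  (for an edge, its two ends). \<open>send s q\<close> is the message, if any, that a processor with memory
  \<open>s\<close> addresses to \<open>q\<close>. The algorithm ends as soon as \<open>stop\<close> holds; it may be any test of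
  the memories of all processors, so that no restriction is placed on how the end is detected.
\<close>

record ('s, 'm) algorithm =
  init :: "node \<Rightarrow> 's"
  update :: "'s \<Rightarrow> 'm multiset \<Rightarrow> 's"
  send :: "'s \<Rightarrow> node \<Rightarrow> 'm option"
  held :: "'s \<Rightarrow> node set"
  contents :: "'m \<Rightarrow> node set"
  label :: "'s \<Rightarrow> nat"
  stop :: "(node \<rightharpoonup> 's) \<Rightarrow> bool"

text \<open>\<open>inbox c p\<close> consists of the messages sent to \<open>p\<close> in the last step, read in the next one.\<close>

record ('s, 'm) configuration =
  memory :: "node \<Rightarrow> 's"
  knows :: "node \<Rightarrow> node set"
  inbox :: "node \<Rightarrow> 'm multiset"

text \<open>
  An edge is also taken to know itself; otherwise no message could ever contain an edge.
\<close>

fun initial_knowledge :: "node \<Rightarrow> node set" where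
  "initial_knowledge (Vert v) = {Vert v}"
| "initial_knowledge (Edge e) = insert (Edge e) (Vert ` e)"

definition initial_configuration :: "('s, 'm) algorithm \<Rightarrow> ('s, 'm) configuration" where
  "initial_configuration A =
    \<lparr>memory = init A, knows = initial_knowledge, inbox = (\<lambda>_. {#})\<rparr>"

definition step ::
  "('s, 'm) algorithm \<Rightarrow> node set \<Rightarrow> ('s, 'm) configuration \<Rightarrow> ('s, 'm) configuration" where
  "step A N c =
    (let mem = (\<lambda>p. update A (memory c p) (inbox c p));
         kn = (\<lambda>p. knows c p \<union> (\<Union>m \<in> set_mset (inbox c p). contents A m))
     in \<lparr>memory = mem, knows = kn,
         inbox = (\<lambda>q. image_mset (\<lambda>p. the (send A (mem p) q))
                        (mset_set {p \<in> N. q \<in> kn p \<and> send A (mem p) q \<noteq> None}))\<rparr>)"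

definition run ::
  "('s, 'm) algorithm \<Rightarrow> nat \<Rightarrow> nat set set \<Rightarrow> nat \<Rightarrow> ('s, 'm) configuration" where
  "run A n E t = (step A (nodes n E) ^^ t) (initial_configuration A)"

text \<open>
  A processor holds in its memory, and puts into its messages, only vertices and edges it knows
  about. (The restriction on the addressees of messages is part of \<open>step\<close>.)
\<close>

definition respects_knowledge :: "('s, 'm) algorithm \<Rightarrow> nat \<Rightarrow> nat set set \<Rightarrow> bool" where
  "respects_knowledge A n E \<longleftrightarrow>
    (\<forall>t. \<forall>p \<in> nodes n E.
      held A (memory (run A n E t) p) \<subseteq> knows (run A n E t) p \<and>
      (t > 0 \<longrightarrow> (\<forall>q \<in> knows (run A n E t) p. \<forall>m.
        send A (memory (run A n E t) p) q = Some m \<longrightarrow>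
          contents A m \<subseteq> knows (run A n E t) p)))"

definition stopped_at :: "('s, 'm) algorithm \<Rightarrow> nat \<Rightarrow> nat set set \<Rightarrow> nat \<Rightarrow> bool" where
  "stopped_at A n E t \<longleftrightarrow>
    stop A (\<lambda>p. if p \<in> nodes n E then Some (memory (run A n E t) p) else None)"

definition steps_taken :: "('s, 'm) algorithm \<Rightarrow> nat \<Rightarrow> nat set set \<Rightarrow> nat" where
  "steps_taken A n E = (LEAST t. stopped_at A n E t)"

definition final_memory :: "('s, 'm) algorithm \<Rightarrow> nat \<Rightarrow> nat set set \<Rightarrow> nat \<Rightarrow> 's" where
  "final_memory A n E v = memory (run A n E (steps_taken A n E)) (Vert v)"

definition final_label :: "('s, 'm) algorithm \<Rightarrow> nat \<Rightarrow> nat set set \<Rightarrow> nat \<Rightarrow> nat" where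
  "final_label A n E v = label A (final_memory A n E v)"

definition message_passing_algorithm :: "nat \<Rightarrow> ('s, 'm) algorithm \<Rightarrow> bool" where
  "message_passing_algorithm n A \<longleftrightarrow>
    (\<forall>E. simple_graph n E \<longrightarrow> respects_knowledge A n E)"

definition computes_components :: "nat \<Rightarrow> ('s, 'm) algorithm \<Rightarrow> bool" where
  "computes_components n A \<longleftrightarrow>
    (\<forall>E. simple_graph n E \<longrightarrow>
      (\<exists>t. stopped_at A n E t) \<and>
      (\<forall>v \<in> {1..n}.
        Vert (final_label A n E v) \<in> held A (final_memory A n E v) \<and>
        final_label A n E v \<in> component_of E v) \<and>
      (\<forall>u \<in> {1..n}. \<forall>v \<in> {1..n}.
        final_label A n E u = final_label A n E v \<longleftrightarrow> component_of E u = component_of E v))"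

end

theory Submission
  imports Defs
begin

text \<open>
  If \<open>p\<close> knows about \<open>q\<close> and \<open>x\<close>, then \<open>p\<close> can tell \<open>q\<close> about \<open>x\<close>, so one step at most doubles the
  distance over which processors know about each other; after \<open>t\<close> steps it is at most \<open>2 ^ t\<close>. In
  the end two vertices at distance \<open>d\<close> in a common component both know its label, so
  \<open>d \<le> 2 * 2 ^ t\<close>.
\<close>

fun ends :: "node \<Rightarrow> nat set" where
  "ends (Vert v) = {v}"
| "ends (Edge e) = e"

text \<open>Quantifying over all ends makes bounds add exactly under composition, with no extra term
  for crossing an edge processor. Asking for a walk, rather than bounding \<open>graph_dist\<close>,
  also asserts connectedness.\<close>

definition near :: "nat set set \<Rightarrow> nat \<Rightarrow> node \<Rightarrow> node \<Rightarrow> bool" where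
  "near E k p q \<longleftrightarrow> (\<forall>u \<in> ends p. \<forall>v \<in> ends q. \<exists>j \<le> k. (u, v) \<in> adj E ^^ j)"

lemma sym_adj: "sym (adj E)"
  by (auto simp: sym_def adj_def insert_commute)

lemma sym_relpow:
  assumes "sym R" shows "sym (R ^^ k)"
proof (induction k)
  case 0
  then show ?case by (simp add: sym_Id)
next
  case (Suc k)
  have "(R ^^ Suc k)\<inverse> = R\<inverse> O (R ^^ k)\<inverse>"
    by (simp add: converse_relcomp)
  \<comment> \<open>Taking the converse reversed the two factors; a power of \<open>R\<close>
    commutes with \<open>R\<close>, so they can be swapped back.\<close>
  also have "\<dots> = R ^^ Suc k"
    using Suc assms by (simp add: sym_conv_converse_eq relpow_commute)
  finally show ?case by (simp add: sym_conv_converse_eq)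
qed

lemma near_sym: "near E k p q \<Longrightarrow> near E k q p"
  unfolding near_def by (meson sym_adj sym_relpow symD)

lemma near_mono: "near E k p q \<Longrightarrow> k \<le> l \<Longrightarrow> near E l p q"
  unfolding near_def by (meson le_trans)

lemma near_trans:
  assumes "near E k p q" "near E l q r" "ends q \<noteq> {}"
  shows "near E (k + l) p r"
  unfolding near_def
proof (intro ballI)
  fix u w assume "u \<in> ends p" "w \<in> ends r"
  \<comment> \<open>Some end of \<open>q\<close> must exist to join the two walks; otherwise both
    hypotheses would be vacuous.\<close>
  obtain v where "v \<in> ends q" using assms(3) by blast
  obtain i where "i \<le> k" "(u, v) \<in> adj E ^^ i"
    using assms(1) \<open>u \<in> ends p\<close> \<open>v \<in> ends q\<close> unfolding near_def by blast
  moreover obtain j where "j \<le> l" "(v, w) \<in> adj E ^^ j"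
    using assms(2) \<open>v \<in> ends q\<close> \<open>w \<in> ends r\<close> unfolding near_def by blast
  ultimately have "i + j \<le> k + l" "(u, w) \<in> adj E ^^ (i + j)"
    by (auto simp: relpow_add)
  then show "\<exists>j\<le>k + l. (u, w) \<in> adj E ^^ j" by blast
qed

lemma graph_dist_le_if_near:
  "near E k (Vert u) (Vert v) \<Longrightarrow> graph_dist E u v \<le> k"
  unfolding near_def graph_dist_def by (auto intro: Least_le le_trans)

lemma ends_nonempty: "simple_graph n E \<Longrightarrow> p \<in> nodes n E \<Longrightarrow> ends p \<noteq> {}"
  by (auto simp: nodes_def simple_graph_def)

lemma finite_nodes:
  assumes "simple_graph n E" shows "finite (nodes n E)"
proof -
  have "E \<subseteq> Pow {1..n}" using assms by (auto simp: simple_graph_def)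
  then have "finite E" by (rule finite_subset) simp
  then show ?thesis by (simp add: nodes_def)
qed

text \<open>A vertex starts with distance 0, but an edge knows both its ends, which are adjacent.
  The bound 1 is \<open>2 ^ 0\<close>, the start of the doubling.\<close>

lemma near_if_initially_known:
  assumes "simple_graph n E" "p \<in> nodes n E" "q \<in> initial_knowledge p"
  shows "near E 1 p q"
proof (cases p)
  case (Vert v)
  then show ?thesis using assms(3) by (auto simp: near_def intro: exI[of _ 0])
next
  case (Edge e)
  then have "e \<in> E" using assms(2) by (auto simp: nodes_def)
  then obtain a b where e: "e = {a, b}"
    using assms(1) by (auto simp: simple_graph_def card_2_iff)
  have "\<exists>j\<le>1. (u, v) \<in> adj E ^^ j" if "u \<in> e" "v \<in> e" for u v
  proof (cases "u = v")
    case True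
    then show ?thesis by (intro exI[of _ 0]) simp
  next
    case False
    then have "{u, v} = e" using that e by auto
    then show ?thesis using \<open>e \<in> E\<close> by (intro exI[of _ 1]) (simp add: adj_def)
  qed
  moreover have "ends q \<subseteq> e" using assms(3) Edge by auto
  ultimately show ?thesis using Edge by (auto simp: near_def)
qed

lemma run_Suc: "run A n E (Suc t) = step A (nodes n E) (run A n E t)"
  by (simp add: run_def)

lemma knows_step:
  "knows (step A N c) p = knows c p \<union> (\<Union>m \<in> set_mset (inbox c p). contents A m)"
  by (simp add: step_def Let_def)

lemma inbox_stepE:
  assumes "m \<in># inbox (step A N c) q" "finite N"
  obtains p where "p \<in> N" "q \<in> knows (step A N c) p"
    "send A (memory (step A N c) p) q = Some m"
  using assms by (fastforce simp: step_def Let_def)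

text \<open>The second conjunct makes the induction work: messages in the inbox at time
  \<open>t\<close> are read only in the next step, so their contents may already use the bound for
  time \<open>Suc t\<close>.\<close>

lemma near_if_known:
  assumes graph: "simple_graph n E" and A: "respects_knowledge A n E"
  shows "(\<forall>p \<in> nodes n E. \<forall>q \<in> knows (run A n E t) p. near E (2 ^ t) p q) \<and>
    (\<forall>q. \<forall>m \<in># inbox (run A n E t) q. \<forall>x \<in> contents A m. near E (2 ^ Suc t) q x)"
proof (induction t)
  case 0
  \<comment> \<open>All inboxes are empty at time 0, so only initial knowledge matters.\<close>
  show ?case
    using near_if_initially_known[OF graph] by (simp add: run_def initial_configuration_def)
next
  case (Suc t)
  have known: "near E (2 ^ Suc t) p q"
    if "p \<in> nodes n E" "q \<in> knows (run A n E (Suc t)) p" for p q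
  proof -
    have "q \<in> knows (run A n E t) p \<or> (\<exists>m \<in># inbox (run A n E t) p. q \<in> contents A m)"
      using that(2) by (simp add: run_Suc knows_step)
    then show ?thesis
      using Suc that(1) near_mono[of E "2 ^ t" p q "2 ^ Suc t"] by auto
  qed
  have "near E (2 ^ Suc (Suc t)) q x"
    if m: "m \<in># inbox (run A n E (Suc t)) q" and x: "x \<in> contents A m" for q m x
  proof -
    obtain p where p: "p \<in> nodes n E" "q \<in> knows (run A n E (Suc t)) p"
      "send A (memory (run A n E (Suc t)) p) q = Some m"
      using inbox_stepE[OF m[unfolded run_Suc] finite_nodes[OF graph]]
      by (metis run_Suc)
    \<comment> \<open>The limit on message contents applies only at positive times; this message was
      sent at time \<open>Suc t\<close>.\<close>
    then have "x \<in> knows (run A n E (Suc t)) p"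
      using A x unfolding respects_knowledge_def by (meson subsetD zero_less_Suc)
    \<comment> \<open>The doubling: the sender \<open>p\<close> knows both \<open>q\<close> and
      \<open>x\<close>, and as a node of the graph it has an end to pass through.\<close>
    then have "near E (2 ^ Suc t + 2 ^ Suc t) q x"
      using near_trans near_sym known p ends_nonempty[OF graph] by meson
    then show ?thesis by (simp add: mult_2)
  qed
  with known show ?case by blast
qed

lemma component_of_eq_if_mem:
  assumes "v \<in> component_of E u" shows "component_of E v = component_of E u"
proof -
  have "equiv UNIV ((adj E)\<^sup>*)"
    by (simp add: equiv_def refl_rtrancl trans_rtrancl sym_rtrancl sym_adj)
  then show ?thesis
    using assms by (simp add: component_of_def equiv_class_eq_iff)
qed

lemma component_of_subset:
  assumes "simple_graph n E" "v \<in> {1..n}"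
  shows "component_of E v \<subseteq> {1..n}"
proof
  fix w assume "w \<in> component_of E v"
  then have "(v, w) \<in> (adj E)\<^sup>*" by (simp add: component_of_def)
  then show "w \<in> {1..n}"
  proof (cases rule: rtranclE)
    case base
    then show ?thesis using assms(2) by simp
  next
    case (step u)
    then show ?thesis using assms(1) by (auto simp: adj_def simple_graph_def)
  qed
qed

text \<open>Both maxima range over finite nonempty sets: there is a component because
  \<open>n \<ge> 1\<close>, and each component lies in \<open>{1..n}\<close>.\<close>

lemma max_diameter_attained:
  assumes "n \<ge> 1" "simple_graph n E"
  obtains u v where "u \<in> {1..n}" "v \<in> {1..n}" "component_of E u = component_of E v"
    "graph_dist E u v = max_diameter n E"
proof -
  have comps: "components n E = component_of E ` {1..n}"
    by (auto simp: components_def component_of_def quotient_def)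
  have "max_diameter n E \<in> diameter E ` components n E"
    unfolding max_diameter_def using assms(1) comps by (intro Max_in) auto
  then obtain x where x: "x \<in> {1..n}" "max_diameter n E = diameter E (component_of E x)"
    using comps by auto
  let ?C = "component_of E x"
  have C: "?C \<subseteq> {1..n}" using component_of_subset assms(2) x(1) by simp
  have "x \<in> ?C" by (simp add: component_of_def)
  have image: "{graph_dist E u v |u v. u \<in> ?C \<and> v \<in> ?C} = (\<lambda>(u, v). graph_dist E u v) ` (?C \<times> ?C)"
    by auto
  have "finite ?C" using C by (rule finite_subset) simp
  then have "max_diameter n E \<in> {graph_dist E u v |u v. u \<in> ?C \<and> v \<in> ?C}"
    unfolding x(2) diameter_def image using \<open>x \<in> ?C\<close> by (intro Max_in) auto
  then obtain u v where "u \<in> ?C" "v \<in> ?C" "max_diameter n E = graph_dist E u v" by auto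
  then show thesis
    using that[of u v] C component_of_eq_if_mem by (metis subsetD)
qed

lemma max_diameter_le:
  fixes A :: "('s, 'm) algorithm"
  assumes "n \<ge> 1" and A: "message_passing_algorithm n A" "computes_components n A"
    and graph: "simple_graph n E"
  shows "max_diameter n E \<le> 2 ^ Suc (steps_taken A n E)"
proof -
  let ?t = "steps_taken A n E"
  obtain u v where uv: "u \<in> {1..n}" "v \<in> {1..n}" "component_of E u = component_of E v"
      "graph_dist E u v = max_diameter n E"
    using max_diameter_attained assms(1) graph by blast
  have resp: "respects_knowledge A n E"
    using A(1) graph by (simp add: message_passing_algorithm_def)
  have near: "near E (2 ^ ?t) (Vert w) (Vert (final_label A n E w))" if "w \<in> {1..n}" for w
  proof -
    have w: "Vert w \<in> nodes n E" using that by (simp add: nodes_def)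
    have "Vert (final_label A n E w) \<in> held A (final_memory A n E w)"
      using A(2) graph that by (simp add: computes_components_def)
    then have "Vert (final_label A n E w) \<in> knows (run A n E ?t) (Vert w)"
      using resp w unfolding respects_knowledge_def final_memory_def by blast
    then show ?thesis using near_if_known[OF graph resp] w by blast
  qed
  have "final_label A n E u = final_label A n E v"
    using A(2) graph uv by (simp add: computes_components_def)
  \<comment> \<open>The common label is the midpoint: \<open>u\<close> and \<open>v\<close> each
    hold it, hence know it.\<close>
  then have "near E (2 ^ ?t + 2 ^ ?t) (Vert u) (Vert v)"
    using near_trans[OF near[OF uv(1)]] near_sym[OF near[OF uv(2)]] by simp
  then show ?thesis using graph_dist_le_if_near uv(4) by (fastforce simp: mult_2)
qed

theorem theorem1:
  "\<exists>c > 0. \<exists>d0. \<forall>n \<ge> 1. \<forall>(A :: ('s, 'm) algorithm) E.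
     message_passing_algorithm n A \<and> computes_components n A \<and>
     simple_graph n E \<and> max_diameter n E \<ge> d0 \<longrightarrow>
       real (steps_taken A n E) \<ge> c * log 2 (real (max_diameter n E))"
\<comment> \<open>From \<open>d \<le> 2 ^ (t + 1)\<close> follows
  \<open>t \<ge> log 2 d - 1\<close>, and this is at least half of \<open>log 2 d\<close> once
  \<open>log 2 d \<ge> 2\<close>, that is, \<open>d \<ge> 4\<close>.\<close>
proof (intro exI[of _ "1 / 2"] exI[of _ 4] conjI allI impI; (elim conjE)?)
  fix n :: nat and A :: "('s, 'm) algorithm" and E
  let ?d = "max_diameter n E" and ?t = "steps_taken A n E"
  assume "n \<ge> 1" "message_passing_algorithm n A" "computes_components n A"
    "simple_graph n E" and d: "4 \<le> ?d"
  then have "real ?d \<le> real (2 ^ Suc ?t)"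
    by (intro of_nat_mono max_diameter_le)
  then have "real ?d \<le> 2 powr real (Suc ?t)"
    by (simp add: powr_realpow del: of_nat_Suc)
  then have "log 2 (real ?d) \<le> real (Suc ?t)"
    using d by (subst log_le_iff) auto
  moreover have "2 \<le> log 2 (real ?d)"
    using d by (subst le_log_iff) auto
  ultimately show "1 / 2 * log 2 (real ?d) \<le> real ?t" by simp
qed simp

end
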